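(* Let $J$ be a complex structure on a $6$-dimensional $3$-step nilpotent Lie algebra $\mathfrak{g}$ admitting a basis $\{\omega^1,\omega^2,\omega^3\}$ of $\mathfrak{g}^{1,0}$ with $$d\omega^1=0,\qquad d\omega^2=\omega^{1\bar1},\qquad d\omega^3=\omega^{12}+B\,\omega^{1\bar 2}+c\,\omega^{2\bar 1},$$ where $B\in\mathbb{C}$ and $c\in\mathbb{R}$, $c\ge 0$. Then $\mathfrak{g}$ has $3$-dimensional center if and only if $|B|=1$, $B\neq 1$ and $c=0$. In such case $\mathfrak{g}$ is isomorphic to $\mathfrak{h}_{16}$.
   Context: A complex structure on a real Lie algebra $\mathfrak{g}$ is an endomorphism $J$ with $J^2=-\mathrm{Id}$ and $[JX,JY]=J[JX,Y]+J[X,JY]+[X,Y]$ for all $X,Y$. $\mathfrak{g}^{1,0}\subset\mathfrak{g}_{\mathbb{C}}^*$ is the $i$-eigenspace of $J$ acting on $\mathfrak{g}_{\mathbb{C}}^*$; $d$ is the Chevalley–Eilenberg differential. Notation: $\omega^{jk}=\omega^j\wedge\omega^k$, $\omega^{j\bar k}=\omega^j\wedge\overline{\omega^k}$. $\mathfrak{h}_{16}=(0,0,0,12,14,24)$: the $6$-dimensional real Lie algebra whose dual has a basis $e^1,\dots,e^6$ with $de^1=de^2=de^3=0$, $de^4=e^1\wedge e^2$, $de^5=e^1\wedge e^4$, $de^6=e^2\wedge e^4$. *)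

theory Defs
  imports "HOL-Analysis.Analysis" "HOL-Library.Function_Algebras"
begin

locale lie_algebra =
  fixes bracket :: "'g::real_vector \<Rightarrow> 'g \<Rightarrow> 'g"
  assumes bilinear_bracket: "bilinear bracket"
    and bracket_self: "bracket X X = 0"
    and jacobi: "bracket X (bracket Y Z) + bracket Y (bracket Z X) + bracket Z (bracket X Y) = 0"

definition lie_center :: "('g::real_vector \<Rightarrow> 'g \<Rightarrow> 'g) \<Rightarrow> 'g set" where
  "lie_center br = {X. \<forall>Y. br X Y = 0}"

primrec lower_central_series :: "('g::real_vector \<Rightarrow> 'g \<Rightarrow> 'g) \<Rightarrow> nat \<Rightarrow> 'g set" where
  "lower_central_series br 0 = UNIV"
| "lower_central_series br (Suc k) = span {br X Y | X Y. X \<in> lower_central_series br k}"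

definition nilpotent_of_step :: "nat \<Rightarrow> ('g::real_vector \<Rightarrow> 'g \<Rightarrow> 'g) \<Rightarrow> bool" where
  "nilpotent_of_step s br \<longleftrightarrow>
     lower_central_series br s = {0} \<and> (\<forall>k<s. lower_central_series br k \<noteq> {0})"

definition lie_isomorphic ::
  "('g::real_vector \<Rightarrow> 'g \<Rightarrow> 'g) \<Rightarrow> ('h::real_vector \<Rightarrow> 'h \<Rightarrow> 'h) \<Rightarrow> bool" where
  "lie_isomorphic br br' \<longleftrightarrow>
     (\<exists>f. linear f \<and> bij f \<and> (\<forall>X Y. f (br X Y) = br' (f X) (f Y)))"

definition complex_structure :: "('g::real_vector \<Rightarrow> 'g \<Rightarrow> 'g) \<Rightarrow> ('g \<Rightarrow> 'g) \<Rightarrow> bool" where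
  "complex_structure br J \<longleftrightarrow> linear J \<and> (\<forall>X. J (J X) = - X) \<and>
     (\<forall>X Y. br (J X) (J Y) = J (br (J X) Y) + J (br X (J Y)) + br X Y)"

text \<open>
  The complexified dual of \<open>\<gg>\<close> is identified with the space of real-linear maps
  \<open>\<gg> \<rightarrow> \<complex>\<close>, a complex vector space under pointwise operations; likewise a complex
  2-form is given by its values on \<open>\<gg> \<times> \<gg>\<close>. The operations on forms below take values in
  an arbitrary ring, so that they serve both for real and for complex forms.
\<close>

definition scale_form :: "complex \<Rightarrow> ('g \<Rightarrow> complex) \<Rightarrow> 'g \<Rightarrow> complex" where
  "scale_form a \<alpha> = (\<lambda>X. a * \<alpha> X)"

global_interpretation form: vector_space scale_form
  by standard (auto simp: scale_form_def fun_eq_iff algebra_simps)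

definition complex_dual :: "('g::real_vector \<Rightarrow> complex) set" where
  "complex_dual = {\<alpha>. linear \<alpha>}"

definition conj_form :: "('g \<Rightarrow> complex) \<Rightarrow> 'g \<Rightarrow> complex" where
  "conj_form \<alpha> = (\<lambda>X. cnj (\<alpha> X))"

definition wedge :: "('g \<Rightarrow> 'k::comm_ring_1) \<Rightarrow> ('g \<Rightarrow> 'k) \<Rightarrow> 'g \<Rightarrow> 'g \<Rightarrow> 'k" where
  "wedge \<alpha> \<beta> = (\<lambda>X Y. \<alpha> X * \<beta> Y - \<alpha> Y * \<beta> X)"

text \<open>The Chevalley--Eilenberg differential on 1-forms.\<close>

definition ce_d :: "('g \<Rightarrow> 'g \<Rightarrow> 'g) \<Rightarrow> ('g \<Rightarrow> 'k::comm_ring_1) \<Rightarrow> 'g \<Rightarrow> 'g \<Rightarrow> 'k" where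
  "ce_d br \<alpha> = (\<lambda>X Y. - \<alpha> (br X Y))"

text \<open>The action of \<open>J\<close> on forms is the transpose, \<open>(J \<alpha>)(X) = \<alpha> (J X)\<close>.\<close>

definition forms_1_0 :: "('g::real_vector \<Rightarrow> 'g) \<Rightarrow> ('g \<Rightarrow> complex) set" where
  "forms_1_0 J = {\<alpha> \<in> complex_dual. \<alpha> \<circ> J = scale_form \<i> \<alpha>}"

definition is_form_basis :: "('g \<Rightarrow> complex) list \<Rightarrow> ('g \<Rightarrow> complex) set \<Rightarrow> bool" where
  "is_form_basis ws V \<longleftrightarrow> distinct ws \<and> form.independent (set ws) \<and> form.span (set ws) = V"

text \<open>
  \<open>\<hh>\<^sub>1\<^sub>6\<close> is realised on \<open>\<real>\<^sup>6\<close>, with \<open>e\<^sup>1, \<dots>, e\<^sup>6\<close> the coordinate forms. In the index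
  type \<open>6\<close> the numerals denote residues, so the last coordinate is \<open>6 = 0\<close>. The bracket is
  dictated by \<open>e\<^sup>k([x, y]) = - de\<^sup>k(x, y)\<close>; see \<open>h16_structure_equations\<close>.
\<close>

definition coord_form :: "6 \<Rightarrow> real^6 \<Rightarrow> real" where
  "coord_form k = (\<lambda>x. x $ k)"

definition h16_bracket :: "real^6 \<Rightarrow> real^6 \<Rightarrow> real^6" where
  "h16_bracket x y = (\<chi> k.
     if k = 4 then - wedge (coord_form 1) (coord_form 2) x y
     else if k = 5 then - wedge (coord_form 1) (coord_form 4) x y
     else if k = 6 then - wedge (coord_form 2) (coord_form 4) x y
     else 0)"

lemma h16_structure_equations:
  "ce_d h16_bracket (coord_form 1) = 0"
  "ce_d h16_bracket (coord_form 2) = 0"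
  "ce_d h16_bracket (coord_form 3) = 0"
  "ce_d h16_bracket (coord_form 4) = wedge (coord_form 1) (coord_form 2)"
  "ce_d h16_bracket (coord_form 5) = wedge (coord_form 1) (coord_form 4)"
  "ce_d h16_bracket (coord_form 6) = wedge (coord_form 2) (coord_form 4)"
  by (simp_all add: fun_eq_iff ce_d_def coord_form_def h16_bracket_def)

lemma lie_algebra_h16: "lie_algebra h16_bracket"
proof
  show "bilinear h16_bracket"
    unfolding bilinear_def linear_iff
    by (auto simp: vec_eq_iff h16_bracket_def wedge_def coord_form_def algebra_simps)
next
  fix x y z :: "real^6"
  show "h16_bracket x x = 0"
    by (simp add: vec_eq_iff h16_bracket_def wedge_def)
  show "h16_bracket x (h16_bracket y z) + h16_bracket y (h16_bracket z x)
      + h16_bracket z (h16_bracket x y) = 0"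
    by (simp add: vec_eq_iff h16_bracket_def wedge_def coord_form_def algebra_simps)
qed

end

theory Submission imports Defs begin

text \<open>
  The coframe gives a real isomorphism \<open>\<gg> \<rightarrow> \<complex>\<^sup>3\<close>. Testing the structure equations against all
  vectors shows that it maps the center onto \<open>{0} \<times> K \<times> \<complex>\<close>, where
  \<open>K = {z. z + B \<cdot> cnj z = 0 \<and> c \<cdot> z = 0}\<close>. Since \<open>K\<close> is never all of \<open>\<complex>\<close>, the center has dimension
  3 iff \<open>K \<noteq> 0\<close>, which amounts to \<open>|B| = 1\<close> and \<open>c = 0\<close>; for \<open>B = 1\<close> and \<open>c = 0\<close> the commutators,
  which have \<open>\<omega>\<^sup>1 = 0\<close> and \<open>\<omega>\<^sup>2\<close> imaginary, would be central and the algebra 2-step.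
  For \<open>|B| = 1\<close>, \<open>B \<noteq> 1\<close> and \<open>c = 0\<close>, the form \<open>\<omega>\<^sup>2 + B \<cdot> cnj \<omega>\<^sup>2\<close> is \<open>\<i> (1 - B)\<close> times a real form \<open>u\<close>
  with \<open>d u = -2 e\<^sup>1 \<and> e\<^sup>2\<close>, where \<open>\<omega>\<^sup>1 = e\<^sup>1 + \<i> e\<^sup>2\<close>, so that \<open>d \<omega>\<^sup>3 = \<i> (1 - B) (e\<^sup>1 + \<i> e\<^sup>2) \<and> u\<close>.
\<close>

section \<open>Dimensions under injective linear maps\<close>

lemma dim_image_inj:
  fixes f :: "'a::real_vector \<Rightarrow> 'b::real_vector"
  assumes "linear f" and "inj f"
  shows "dim (f ` S) = dim S"
proof -
  obtain b where b: "b \<subseteq> S" "independent b" "S \<subseteq> span b" "card b = dim S"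
    by (rule basis_exists)
  have "independent (f ` b)"
    using assms b(2) by (simp add: linear_independent_injective_image inj_on_subset)
  moreover have "span (f ` b) = span (f ` S)"
    using b by (metis linear_span_image[OF assms(1)] span_eq span_superset subset_trans)
  ultimately have "dim (f ` S) = card (f ` b)"
    by (rule dim_eq_card[rotated])
  also have "\<dots> = card b"
    using assms(2) by (simp add: card_image inj_on_subset)
  finally show ?thesis using b(4) by simp
qed

text \<open>The domain is only a \<open>real_vector\<close>, so the count takes place in the
  Euclidean codomain: the range is a subspace of full dimension.\<close>

lemma linear_inj_imp_bij:
  fixes f :: "'a::real_vector \<Rightarrow> 'b::euclidean_space"
  assumes "linear f" and "inj f" and "dim (UNIV :: 'a set) = DIM('b)"
  shows "bij f"
proof -
  have "dim (range f) = DIM('b)"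
    using assms by (simp add: dim_image_inj)
  then have "span (range f) = UNIV"
    by (simp add: dim_eq_full)
  then have "range f = UNIV"
    using linear_subspace_image[OF assms(1) subspace_UNIV] span_eq_iff by blast
  with assms(2) show ?thesis by (simp add: bij_def)
qed

section \<open>Separation of vectors by (1,0)-forms\<close>

lemma separating_functional:
  fixes X :: "'a::real_vector"
  assumes "X \<noteq> 0"
  obtains f :: "'a \<Rightarrow> real" where "linear f" and "f X = 1"
proof -
  have "independent {X}" using assms by simp
  from linear_independent_extend[OF this, of "\<lambda>_. 1::real"] show ?thesis
    using that by auto
qed

text \<open>Every real functional \<open>f\<close> is the real part of the (1,0)-form
  \<open>f - \<i> * (f \<circ> J)\<close>, so a functional with \<open>f X = 1\<close> yields a
  (1,0)-form that does not vanish at \<open>X\<close>.\<close>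

lemma forms_1_0_separate:
  assumes J: "complex_structure br J" and z: "\<And>\<alpha>. \<alpha> \<in> forms_1_0 J \<Longrightarrow> \<alpha> X = 0"
  shows "X = 0"
proof (rule ccontr)
  assume "X \<noteq> 0"
  then obtain f :: "'a \<Rightarrow> real" where f: "linear f" "f X = 1"
    by (rule separating_functional)
  have lJ: "linear J" and JJ: "J (J Y) = - Y" for Y
    using J by (auto simp: complex_structure_def)
  define \<alpha> where "\<alpha> = (\<lambda>Y. Complex (f Y) (- f (J Y)))"
  have "linear \<alpha>"
    by (rule linearI)
      (simp_all add: \<alpha>_def complex_eq_iff linear_add[OF f(1)] linear_add[OF lJ]
        linear_scale[OF f(1)] linear_scale[OF lJ])
  moreover have "\<alpha> \<circ> J = scale_form \<i> \<alpha>"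
    by (auto simp: fun_eq_iff \<alpha>_def scale_form_def complex_eq_iff JJ linear_neg[OF f(1)])
  ultimately have "\<alpha> \<in> forms_1_0 J"
    by (simp add: forms_1_0_def complex_dual_def)
  from z[OF this] f(2) show False
    by (simp add: \<alpha>_def complex_eq_iff)
qed

lemma form_span_vanish:
  assumes "\<alpha> \<in> form.span S" and "\<And>\<beta>. \<beta> \<in> S \<Longrightarrow> \<beta> X = 0"
  shows "\<alpha> X = 0"
  using assms(1)
proof (induction rule: form.span_induct_alt)
  case base
  then show ?case by simp
next
  case (step a x y)
  then show ?case using assms(2) by (simp add: scale_form_def)
qed

text \<open>Conjugation makes the condition linear over the reals only, so a line is possible. A
  proper real subspace of \<complex> has dimension 0 or 1.\<close>

lemma conj_semilinear_kernel_dim: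
  fixes B :: complex and c :: real
  defines "K \<equiv> {z. z + B * cnj z = 0 \<and> of_real c * z = 0}"
  shows "subspace K" and "dim K = 1 \<longleftrightarrow> K \<noteq> {0}"
proof -
  show sub: "subspace K"
  proof (rule subspaceI)
    show "0 \<in> K" by (simp add: K_def)
  next
    fix z w assume "z \<in> K" "w \<in> K"
    then have "(z + B * cnj z) + (w + B * cnj w) = 0" "c = 0 \<or> z + w = 0"
      by (auto simp: K_def)
    then show "z + w \<in> K" by (auto simp: K_def algebra_simps)
  next
    fix r z assume "z \<in> K"
    then have "of_real r * (z + B * cnj z) = 0" "of_real r * (of_real c * z) = 0"
      by (auto simp: K_def)
    then show "r *\<^sub>R z \<in> K"
      by (auto simp: K_def scaleR_conv_of_real algebra_simps)
  qed
  \<comment> \<open>Membership of \<open>1\<close> forces \<open>B = -1\<close>, membership of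
    \<open>\<i>\<close> forces \<open>B = 1\<close>.\<close>
  have "1 \<notin> K \<or> \<i> \<notin> K"
  proof (rule ccontr)
    assume "\<not> ?thesis"
    then have "1 + B = 0" and "\<i> * (1 - B) = 0"
      by (auto simp: K_def algebra_simps)
    then have "1 + B = 0" and "1 = B"
      by auto
    then show False by (metis one_add_one zero_neq_numeral)
  qed
  then have "K \<noteq> UNIV" by auto
  then have "dim K \<noteq> 2"
    using sub dim_eq_full[of K] by (simp add: span_eq_iff[THEN iffD2])
  moreover have "dim K \<le> 2"
    using dim_subset_UNIV[of K] by simp
  ultimately have "dim K = 1 \<longleftrightarrow> dim K \<noteq> 0" by linarith
  also have "\<dots> \<longleftrightarrow> K \<noteq> {0}"
    using subspace_0[OF sub] by (auto simp: dim_eq_0)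
  finally show "dim K = 1 \<longleftrightarrow> K \<noteq> {0}" .
qed

section \<open>The coframe as real coordinates on the Lie algebra\<close>

locale special_coframe =
  fixes br :: "'g::real_vector \<Rightarrow> 'g \<Rightarrow> 'g"
    and J :: "'g \<Rightarrow> 'g"
    and \<omega>1 \<omega>2 \<omega>3 :: "'g \<Rightarrow> complex"
    and B :: complex and c :: real
  assumes lie: "lie_algebra br"
    and dim6: "dim (UNIV :: 'g set) = 6"
    and cs: "complex_structure br J"
    and basis: "is_form_basis [\<omega>1, \<omega>2, \<omega>3] (forms_1_0 J)"
    and d\<omega>1: "\<And>X Y. ce_d br \<omega>1 X Y = 0"
    and d\<omega>2: "\<And>X Y. ce_d br \<omega>2 X Y = wedge \<omega>1 (conj_form \<omega>1) X Y"
    and d\<omega>3: "\<And>X Y. ce_d br \<omega>3 X Y =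
           wedge \<omega>1 \<omega>2 X Y + B * wedge \<omega>1 (conj_form \<omega>2) X Y
           + complex_of_real c * wedge \<omega>2 (conj_form \<omega>1) X Y"
begin

lemma linear_coframe: "linear \<omega>1" "linear \<omega>2" "linear \<omega>3"
proof -
  have "{\<omega>1, \<omega>2, \<omega>3} \<subseteq> forms_1_0 J"
    using basis form.span_superset[of "{\<omega>1, \<omega>2, \<omega>3}"] by (auto simp: is_form_basis_def)
  then show "linear \<omega>1" "linear \<omega>2" "linear \<omega>3"
    by (auto simp: forms_1_0_def complex_dual_def)
qed

text \<open>A vector killed by the coframe is killed by its complex span, which consists of all
  (1,0)-forms.\<close>

lemma coframe_separates:
  assumes "\<omega>1 X = 0" "\<omega>2 X = 0" "\<omega>3 X = 0"
  shows "X = 0"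
proof (rule forms_1_0_separate[OF cs])
  fix \<alpha> assume "\<alpha> \<in> forms_1_0 J"
  then have "\<alpha> \<in> form.span {\<omega>1, \<omega>2, \<omega>3}"
    using basis by (simp add: is_form_basis_def)
  then show "\<alpha> X = 0"
    by (rule form_span_vanish) (use assms in auto)
qed

definition F :: "'g \<Rightarrow> complex \<times> complex \<times> complex" where
  "F X = (\<omega>1 X, \<omega>2 X, \<omega>3 X)"

lemma linear_F: "linear F"
  by (rule linearI) (simp_all add: F_def linear_add linear_scale linear_coframe)

lemma inj_F: "inj F"
  unfolding linear_injective_0[OF linear_F] using coframe_separates
  by (auto simp: F_def zero_prod_def)

lemma bij_F: "bij F"
  by (rule linear_inj_imp_bij[OF linear_F inj_F]) (simp add: dim6)

lemma obtain_coords: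
  obtains X where "\<omega>1 X = x" "\<omega>2 X = y" "\<omega>3 X = z"
proof -
  have "(x, y, z) \<in> range F"
    using bij_F by (simp add: bij_def)
  then obtain X where "(x, y, z) = F X" by blast
  with that show ?thesis by (simp add: F_def)
qed

text \<open>The structure equations with the sign of \<open>ce_d\<close> undone. In the third,
  \<omega>2 is grouped into \<open>z + B * cnj z\<close>, the expression that governs both the
  center and the isomorphism.\<close>

lemma coframe_bracket:
  "\<omega>1 (br X Y) = 0"
  "\<omega>2 (br X Y) = \<omega>1 Y * cnj (\<omega>1 X) - \<omega>1 X * cnj (\<omega>1 Y)"
  "\<omega>3 (br X Y) = \<omega>1 Y * (\<omega>2 X + B * cnj (\<omega>2 X)) - \<omega>1 X * (\<omega>2 Y + B * cnj (\<omega>2 Y))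
     + of_real c * (\<omega>2 Y * cnj (\<omega>1 X) - \<omega>2 X * cnj (\<omega>1 Y))"
proof -
  have "- \<omega>1 (br X Y) = 0"
    using d\<omega>1[of X Y] by (simp add: ce_d_def)
  then show "\<omega>1 (br X Y) = 0" by simp
  have "- \<omega>2 (br X Y) = \<omega>1 X * cnj (\<omega>1 Y) - \<omega>1 Y * cnj (\<omega>1 X)"
    using d\<omega>2[of X Y] by (simp add: ce_d_def wedge_def conj_form_def)
  then show "\<omega>2 (br X Y) = \<omega>1 Y * cnj (\<omega>1 X) - \<omega>1 X * cnj (\<omega>1 Y)"
    by (metis minus_diff_eq minus_minus)
  have "- \<omega>3 (br X Y) = \<omega>1 X * \<omega>2 Y - \<omega>1 Y * \<omega>2 X
      + B * (\<omega>1 X * cnj (\<omega>2 Y) - \<omega>1 Y * cnj (\<omega>2 X))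
      + of_real c * (\<omega>2 X * cnj (\<omega>1 Y) - \<omega>2 Y * cnj (\<omega>1 X))"
    using d\<omega>3[of X Y] by (simp add: ce_d_def wedge_def conj_form_def)
  then have "\<omega>3 (br X Y) = - (\<omega>1 X * \<omega>2 Y - \<omega>1 Y * \<omega>2 X
      + B * (\<omega>1 X * cnj (\<omega>2 Y) - \<omega>1 Y * cnj (\<omega>2 X))
      + of_real c * (\<omega>2 X * cnj (\<omega>1 Y) - \<omega>2 Y * cnj (\<omega>1 X)))"
    by (metis minus_minus)
  then show "\<omega>3 (br X Y) = \<omega>1 Y * (\<omega>2 X + B * cnj (\<omega>2 X)) - \<omega>1 X * (\<omega>2 Y + B * cnj (\<omega>2 Y))
     + of_real c * (\<omega>2 Y * cnj (\<omega>1 X) - \<omega>2 X * cnj (\<omega>1 Y))"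
    by (simp add: algebra_simps)
qed

section \<open>The center in coordinates\<close>

lemma center_iff:
  "X \<in> lie_center br \<longleftrightarrow>
     \<omega>1 X = 0 \<and> \<omega>2 X + B * cnj (\<omega>2 X) = 0 \<and> of_real c * \<omega>2 X = 0"
proof
  assume "X \<in> lie_center br"
  then have "br X Y = 0" for Y by (simp add: lie_center_def)
  then have 2: "\<omega>1 Y * cnj (\<omega>1 X) - \<omega>1 X * cnj (\<omega>1 Y) = 0"
    and 3: "\<omega>1 Y * (\<omega>2 X + B * cnj (\<omega>2 X)) - \<omega>1 X * (\<omega>2 Y + B * cnj (\<omega>2 Y))
     + of_real c * (\<omega>2 Y * cnj (\<omega>1 X) - \<omega>2 X * cnj (\<omega>1 Y)) = 0" for Y
    using coframe_bracket[of X Y] linear_coframe by (simp_all add: linear_0)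
  \<comment> \<open>Against \<open>U\<close> and \<open>V\<close>, equation \<open>2\<close> kills
    the imaginary and the real part of \<open>\<omega>1 X\<close>; equation \<open>3\<close> then
    gives \<open>p - q\<close> and \<open>p + q\<close>, which separates the two conditions on
    \<open>\<omega>2 X\<close>.\<close>
  obtain U where U: "\<omega>1 U = 1" "\<omega>2 U = 0" by (rule obtain_coords)
  obtain V where V: "\<omega>1 V = \<i>" "\<omega>2 V = 0" by (rule obtain_coords)
  have z1: "\<omega>1 X = 0"
    using 2[of U] 2[of V] by (simp add: U V complex_eq_iff)
  define p where "p = \<omega>2 X + B * cnj (\<omega>2 X)"
  define q where "q = of_real c * \<omega>2 X"
  have "p - q = 0" and "\<i> * (p + q) = 0"
    using 3[of U] 3[of V] by (simp_all add: U V z1 p_def q_def algebra_simps)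
  then have "p = 0 \<and> q = 0"
    by (simp add: complex_eq_iff)
  with z1 show "\<omega>1 X = 0 \<and> \<omega>2 X + B * cnj (\<omega>2 X) = 0 \<and> of_real c * \<omega>2 X = 0"
    by (simp add: p_def q_def)
next
  assume X: "\<omega>1 X = 0 \<and> \<omega>2 X + B * cnj (\<omega>2 X) = 0 \<and> of_real c * \<omega>2 X = 0"
  have "br X Y = 0" for Y
  proof (rule coframe_separates)
    show "\<omega>1 (br X Y) = 0" "\<omega>2 (br X Y) = 0"
      using X by (simp_all add: coframe_bracket)
    have "of_real c * (\<omega>2 X * cnj (\<omega>1 Y)) = 0"
      using X by auto
    then show "\<omega>3 (br X Y) = 0"
      using X by (simp add: coframe_bracket)
  qed
  then show "X \<in> lie_center br" by (simp add: lie_center_def)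
qed

lemma dim_center_eq_3_iff:
  "dim (lie_center br) = 3 \<longleftrightarrow> (\<exists>z\<noteq>0. z + B * cnj z = 0 \<and> of_real c * z = 0)"
proof -
  define K where "K = {z. z + B * cnj z = 0 \<and> of_real c * z = 0}"
  have sub: "subspace K" and dim: "dim K = 1 \<longleftrightarrow> K \<noteq> {0}"
    using conj_semilinear_kernel_dim[of B c] by (simp_all add: K_def)
  have "F ` lie_center br = {0} \<times> K \<times> UNIV"
  proof (intro equalityI subsetI)
    fix p assume "p \<in> F ` lie_center br"
    then show "p \<in> {0} \<times> K \<times> UNIV"
      by (auto simp: F_def K_def center_iff)
  next
    fix p assume p: "p \<in> {0 :: complex} \<times> K \<times> (UNIV :: complex set)"
    obtain X where X: "p = F X"
      using bij_F by (metis bij_pointE)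
    with p have "X \<in> lie_center br"
      by (auto simp: F_def K_def center_iff)
    with X show "p \<in> F ` lie_center br" by blast
  qed
  then have "dim (lie_center br) = dim ({0 :: complex} \<times> K \<times> (UNIV :: complex set))"
    using dim_image_inj[OF linear_F inj_F, of "lie_center br"] by simp
  \<comment> \<open>The unconstrained third coordinate contributes the real dimension 2 of
    \<complex>.\<close>
  also have "\<dots> = dim K + 2"
    using sub by (simp add: dim_Times subspace_Times subspace_UNIV)
  finally have "dim (lie_center br) = 3 \<longleftrightarrow> K \<noteq> {0}"
    using dim by auto
  also have "\<dots> \<longleftrightarrow> (\<exists>z\<noteq>0. z \<in> K)"
    using subspace_0[OF sub] by auto
  finally show ?thesis by (simp add: K_def)
qed

lemma subspace_center: "subspace (lie_center br)"
proof -
  have "bilinear br" using lie by (rule lie_algebra.bilinear_bracket)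
  then show ?thesis
    by (auto simp: subspace_def lie_center_def bilinear_lzero bilinear_ladd bilinear_lmul)
qed

lemma two_step:
  assumes "B = 1" and "c = 0"
  shows "lower_central_series br 2 = {0}"
proof -
  \<comment> \<open>For these parameters centrality means that \<omega>1 and the real part of
    \<omega>2 vanish.\<close>
  have "br X Y \<in> lie_center br" for X Y
    using assms by (simp add: center_iff coframe_bracket complex_eq_iff)
  \<comment> \<open>The series starts with the whole algebra at index 0, so index 1 is the derived
    algebra.\<close>
  then have "lower_central_series br 1 \<subseteq> lie_center br"
    unfolding One_nat_def lower_central_series.simps
    by (intro span_minimal subspace_center) auto
  then have "{br X Y | X Y. X \<in> lower_central_series br 1} \<subseteq> {0}"
    by (auto simp: lie_center_def)
  then have "span {br X Y | X Y. X \<in> lower_central_series br 1} \<subseteq> {0}"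
    by (rule span_minimal) (rule subspace_single_0)
  then have "lower_central_series br 2 \<subseteq> {0}"
    by (simp add: numeral_2_eq_2)
  moreover have "0 \<in> lower_central_series br 2"
    by (simp add: numeral_2_eq_2 span_zero)
  ultimately show ?thesis by blast
qed

section \<open>A real coframe adapted to \<open>h16_bracket\<close>\<close>

lemma isomorphic_h16:
  assumes B: "cmod B = 1" "B \<noteq> 1" and c: "c = 0"
  shows "lie_isomorphic br h16_bracket"
proof -
  define b where "b = \<i> * (1 - B)"
  \<comment> \<open>The quotient is already real because \<open>B\<close> has modulus 1: for
    \<open>B = exp (\<i> * \<theta>)\<close> it is the cotangent of
    \<open>\<theta> / 2\<close>.\<close>
  define t where "t = Re ((1 + B) / b)"
  have b0: "b \<noteq> 0" using B by (simp add: b_def)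
  have BB: "B * cnj B = 1"
    using B by (simp add: complex_norm_square[symmetric])
  have "cnj ((1 + B) / b) = (1 + B) / b"
  proof -
    have "cnj (1 + B) * b = (1 + B) * cnj b"
      using BB by (simp add: b_def algebra_simps)
    then show ?thesis
      using b0 by (simp add: field_simps)
  qed
  then have "(1 + B) / b = of_real t"
    by (simp add: t_def Reals_cnj_iff)
  then have bt: "1 + B = b * of_real t"
    using b0 by (simp add: field_simps)
  \<comment> \<open>For \<open>\<omega>2 X = x + \<i> * y\<close>, the sum
    \<open>\<omega>2 X + B * cnj (\<omega>2 X)\<close> is \<open>(1 + B) * x + b * y\<close>, that
    is \<open>b * (t * x + y)\<close>.\<close>
  define u where "u X = Im (\<omega>2 X) + t * Re (\<omega>2 X)" for X
  have u: "\<omega>2 X + B * cnj (\<omega>2 X) = b * of_real (u X)" for X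
  proof -
    have "\<omega>2 X + B * cnj (\<omega>2 X) = (1 + B) * of_real (Re (\<omega>2 X)) + b * of_real (Im (\<omega>2 X))"
      unfolding b_def by (subst (1 2) complex_eq[of "\<omega>2 X"]) (simp add: algebra_simps)
    also have "\<dots> = b * of_real (u X)"
      unfolding bt by (simp add: u_def algebra_simps)
    finally show ?thesis .
  qed
  \<comment> \<open>Dividing by \<open>b\<close> leaves \<open>d v = \<omega>1 \<and> u\<close> with
    \<open>u\<close> real, so real and imaginary parts split into \<open>e1 \<and> u\<close> and
    \<open>e2 \<and> u\<close>.\<close>
  define v where "v X = \<omega>3 X / b" for X
  have v_br: "v (br X Y) = \<omega>1 Y * of_real (u X) - \<omega>1 X * of_real (u Y)" for X Y
    using b0 by (simp add: v_def coframe_bracket u c field_simps)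
  have u_br: "u (br X Y) = - 2 * (Re (\<omega>1 Y) * Im (\<omega>1 X) - Re (\<omega>1 X) * Im (\<omega>1 Y))" for X Y
    by (simp add: u_def coframe_bracket algebra_simps)
  \<comment> \<open>The factors \<open>-1/2\<close> normalise \<open>d u = -2 e1 \<and> e2\<close>
    to \<open>d e4 = e1 \<and> e2\<close> and carry over to \<open>e5\<close> and \<open>e6\<close>.
    The real part of \<omega>2 is closed, since \<omega>2 is imaginary on commutators, and together
    with \<open>u\<close> it recovers \<omega>2. The final \<open>else\<close> is never reached: the
    six numerals exhaust the residues modulo 6.\<close>
  define f :: "'g \<Rightarrow> real^6" where
    "f X = (\<chi> k. if k = 1 then Re (\<omega>1 X) else if k = 2 then Im (\<omega>1 X)
       else if k = 3 then Re (\<omega>2 X) else if k = 4 then - u X / 2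
       else if k = 5 then - Re (v X) / 2 else if k = 6 then - Im (v X) / 2 else 0)" for X
  have lin_u: "linear u"
    unfolding u_def by (rule linearI)
      (simp_all add: linear_add linear_scale linear_coframe algebra_simps)
  have lin_v: "linear v"
    unfolding v_def by (rule linearI)
      (simp_all add: linear_add linear_scale linear_coframe add_divide_distrib scaleR_conv_of_real)
  have linf: "linear f"
    by (rule linearI)
      (simp_all add: f_def vec_eq_iff linear_add linear_scale linear_coframe lin_u lin_v field_simps)
  have "inj f"
    unfolding linear_injective_0[OF linf]
  proof (intro allI impI)
    fix X assume "f X = 0"
    then have *: "f X $ k = 0" for k by simp
    have "\<omega>1 X = 0" and 2: "Re (\<omega>2 X) = 0" "u X = 0" and "v X = 0"
      using *[of 1] *[of 2] *[of 3] *[of 4] *[of 5] *[of 6]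
      by (simp_all add: f_def complex_eq_iff)
    moreover have "\<omega>2 X = 0"
      using 2 by (simp add: u_def complex_eq_iff)
    ultimately show "X = 0"
      using b0 by (intro coframe_separates) (simp_all add: v_def)
  qed
  then have "bij f"
    by (intro linear_inj_imp_bij linf) (simp_all add: dim6)
  moreover have "f (br X Y) = h16_bracket (f X) (f Y)" for X Y
    by (simp add: vec_eq_iff f_def h16_bracket_def wedge_def coord_form_def u_br v_br
        coframe_bracket field_simps)
  ultimately show ?thesis
    using linf unfolding lie_isomorphic_def by blast
qed

end

section \<open>The criterion for a three-dimensional center\<close>

theorem proposition2p16:
  fixes br :: "'g::real_vector \<Rightarrow> 'g \<Rightarrow> 'g"
    and J :: "'g \<Rightarrow> 'g"
    and \<omega>1 \<omega>2 \<omega>3 :: "'g \<Rightarrow> complex"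
    and B :: complex and c :: real
  assumes "lie_algebra br"
    and "dim (UNIV :: 'g set) = 6"
    and "nilpotent_of_step 3 br"
    and "complex_structure br J"
    and "is_form_basis [\<omega>1, \<omega>2, \<omega>3] (forms_1_0 J)"
    and "\<And>X Y. ce_d br \<omega>1 X Y = 0"
    and "\<And>X Y. ce_d br \<omega>2 X Y = wedge \<omega>1 (conj_form \<omega>1) X Y"
    and "\<And>X Y. ce_d br \<omega>3 X Y =
           wedge \<omega>1 \<omega>2 X Y + B * wedge \<omega>1 (conj_form \<omega>2) X Y
           + complex_of_real c * wedge \<omega>2 (conj_form \<omega>1) X Y"
    and "c \<ge> 0"
  shows "(dim (lie_center br) = 3 \<longleftrightarrow> cmod B = 1 \<and> B \<noteq> 1 \<and> c = 0)
       \<and> (cmod B = 1 \<and> B \<noteq> 1 \<and> c = 0 \<longrightarrow> lie_isomorphic br h16_bracket)"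
proof -
  interpret special_coframe br J \<omega>1 \<omega>2 \<omega>3 B c
    by (rule special_coframe.intro) (fact assms)+
  have "lower_central_series br 2 \<noteq> {0}"
    using assms(3) by (simp add: nilpotent_of_step_def)
  then have not2: "\<not> (B = 1 \<and> c = 0)"
    using two_step by blast
  have "dim (lie_center br) = 3 \<longleftrightarrow> cmod B = 1 \<and> B \<noteq> 1 \<and> c = 0"
    unfolding dim_center_eq_3_iff
  proof
    assume "\<exists>z\<noteq>0. z + B * cnj z = 0 \<and> of_real c * z = 0"
    then obtain z where z: "z \<noteq> 0" "z = - (B * cnj z)" "c = 0"
      by (auto simp: add_eq_0_iff2)
    \<comment> \<open>Conjugation preserves the modulus, so a nonzero solution forces
      \<open>cmod B = 1\<close>.\<close>
    have "cmod z = cmod B * cmod z"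
      by (subst z(2)) (simp add: norm_mult)
    with z not2 show "cmod B = 1 \<and> B \<noteq> 1 \<and> c = 0" by auto
  next
    assume B: "cmod B = 1 \<and> B \<noteq> 1 \<and> c = 0"
    then have "B * cnj B = 1"
      by (simp add: complex_norm_square[symmetric])
    \<comment> \<open>The witness works because \<open>B * cnj (1 - B) = B - 1\<close> when
      \<open>B * cnj B = 1\<close>; it is nonzero as \<open>B \<noteq> 1\<close>.\<close>
    with B show "\<exists>z\<noteq>0. z + B * cnj z = 0 \<and> of_real c * z = 0"
      by (intro exI[of _ "1 - B"]) (simp add: algebra_simps)
  qed
  then show ?thesis
    using isomorphic_h16 by blast
qed

end
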